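(* Let $\mu>0$, let $n\ge1$ be an integer, and let the pick times have the Erlang distribution $G(x)=1-e^{-\mu x}\sum_{j=0}^{n-1}\frac{(\mu x)^j}{j!}$, $x\ge0$. Let $r_1,\dots,r_{2n+2}$ be the (simple, nonzero) complex zeros of $R(s)=s^2(\mu^2-s^2)^n+\mu^{2n}$, and let $c_1,\dots,c_{2n+2}$ be the coefficients $c_i=p(r_i)/R'(r_i)$, where $p$ is the polynomial defined in the context. Then the density of the equilibrium waiting time $W$ on $[0,1]$ is $$f(x)=\sum_{i=1}^{2n+2}c_i e^{r_ix},\qquad 0\le x\le1,$$ and $$\pi_0=\mathbb{P}[W=0]=1+\sum_{i=1}^{2n+2}\frac{c_i}{r_i}\,(1-e^{r_i}).$$
   Context: Model: $W_{n+1}=(R_{n+1}-P_n-W_n)^+$ for $n\ge 0$, with $P_0=W_0=0$ and $(x)^+=\max\{0,x\}$, where the pick times $(P_n)_{n\ge1}$ are i.i.d. with distribution function $G$, the rotation times $(R_n)_{n\ge1}$ are i.i.d. uniform on $[0,1)$, and the two sequences are independent. The Markov chain $(W_n)$ has a unique equilibrium distribution; $W$ denotes a random variable with that distribution, i.e. $W$ has the same distribution as $(R-P-W)^+$ with $R$ uniform on $[0,1)$, $P\sim G$, and $R,P,W$ independent. The law of $W$ consists of an atom $\pi_0=\mathbb{P}[W=0]$ at $0$ and a density $f$ on $[0,1]$, which satisfy $$f(x)=\pi_0G(1-x)+\int_0^{1-x}G(1-x-z)f(z)\,dz\quad(0\le x\le 1),\qquad \pi_0+\int_0^1f(x)\,dx=1.$$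 Definition of the coefficients: let $\phi(s)=\int_0^1e^{-sx}f(x)\,dx$ with $\ell$-th derivative $\phi^{(\ell)}$, and let $$A(s)=\pi_0\Big(\mu^{n}+e^{-(\mu+s)}\sum_{j=0}^{n-1}\sum_{i=0}^{j}\frac{s\mu^j(\mu+s)^{n-j-1+i}}{i!}\Big)-e^{-s}(\mu+s)^{n}+e^{-(\mu+s)}\sum_{j=0}^{n-1}\sum_{i=0}^{j}\sum_{\ell=0}^{i}\binom{i}{\ell}\frac{s\mu^j(\mu+s)^{n-j-1+i}}{i!}\,\phi^{(\ell)}(-\mu).$$ Here $\pi_0$ and $\phi^{(\ell)}(-\mu)$, $\ell=0,\dots,n-1$, are regarded as already determined constants (they are the unique solution of the linear equations $e^{-r_i}r_i(\mu+r_i)^nA(-r_i)+\mu^nA(r_i)=0$, $i=1,\dots,n+1$, where the zeros are labelled so that $r_{2n+3-i}=-r_i$ for $i=1,\dots,n+1$). The transform satisfies $\phi(s)R(s)=-e^{-s}s(\mu+s)^nA(-s)-\mu^nA(s)$ for all $s$. Collecting the terms containing $e^{-s}$, the right-hand side is written uniquely as $$-e^{-s}s(\mu+s)^nA(-s)-\mu^nA(s)=p(s)+e^{-s}q(s)$$ with polynomials $p,q$ in $s$; this defines $p$ (denoted $P(s)$ in the paper, not to be confused with the pick time). *)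

theory Defs
  imports
    "HOL-Probability.Probability"
    "HOL-Computational_Algebra.Polynomial"
begin

text \<open>
  The distribution function on the whole line. The library's \<^const>\<open>erlang_CDF\<close> is indexed by
  the number of stages minus one.
\<close>

definition erlang_G :: "nat \<Rightarrow> real \<Rightarrow> real \<Rightarrow> real" where
  "erlang_G n \<mu> x =
     (if x < 0 then 0 else 1 - exp (- \<mu> * x) * (\<Sum>j<n. (\<mu> * x) ^ j / fact j))"

lemma erlang_G_eq_erlang_CDF:
  assumes "n \<ge> 1"
  shows "erlang_G n \<mu> x = erlang_CDF (n - 1) \<mu> x"
proof -
  have "{..n - 1} = {..<n}"
    using assms by auto
  then show ?thesis
    by (simp add: erlang_G_def erlang_CDF_def sum_distrib_left mult.commute)
qed

text \<open>
  \<^term>\<open>L\<close> is the law on the reals with an atom \<^term>\<open>\<pi>0\<close> at 0 and density \<^term>\<open>f\<close> on [0,1].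
  The normalisation of \<^term>\<open>\<pi>0\<close> and \<^term>\<open>f\<close> is the case \<^term>\<open>B = UNIV\<close>.
  Only the values of \<^term>\<open>f\<close> on [0,1] matter.
\<close>

definition has_atom_and_density :: "real measure \<Rightarrow> real \<Rightarrow> (real \<Rightarrow> real) \<Rightarrow> bool" where
  "has_atom_and_density L \<pi>0 f \<longleftrightarrow>
     set_integrable lborel {0..1} f \<and>
     (\<forall>B\<in>sets borel. measure L B = \<pi>0 * indicator B 0 + (LBINT x:B \<inter> {0..1}. f x))"

text \<open>
  A density is determined only almost everywhere. The equation below, imposed at every point of
  [0,1], singles out the version of the density that is meant.
\<close>

definition density_equation :: "(real \<Rightarrow> real) \<Rightarrow> real \<Rightarrow> (real \<Rightarrow> real) \<Rightarrow> bool" where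
  "density_equation G \<pi>0 f \<longleftrightarrow>
     (\<forall>x\<in>{0..1}. f x = \<pi>0 * G (1 - x) + (LBINT z:{0..1 - x}. G (1 - x - z) * f z))"

definition \<phi> :: "(real \<Rightarrow> real) \<Rightarrow> complex \<Rightarrow> complex" where
  "\<phi> f s = (LBINT x:{0..1}. exp (- s * of_real x) * of_real (f x))"

definition A :: "nat \<Rightarrow> real \<Rightarrow> real \<Rightarrow> (real \<Rightarrow> real) \<Rightarrow> complex \<Rightarrow> complex" where
  "A n \<mu> \<pi>0 f s =
     of_real \<pi>0 * (of_real \<mu> ^ n + exp (- (of_real \<mu> + s)) *
       (\<Sum>j<n. \<Sum>i\<le>j. s * of_real \<mu> ^ j * (of_real \<mu> + s) ^ (n - j - 1 + i) / fact i))
     - exp (- s) * (of_real \<mu> + s) ^ n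
     + exp (- (of_real \<mu> + s)) *
       (\<Sum>j<n. \<Sum>i\<le>j. \<Sum>l\<le>i.
          of_nat (i choose l) * (s * of_real \<mu> ^ j * (of_real \<mu> + s) ^ (n - j - 1 + i) / fact i)
          * (deriv ^^ l) (\<phi> f) (- of_real \<mu>))"

text \<open>
  The part free of \<^term>\<open>exp (- s)\<close> when the right-hand side of the transform equation is written
  as \<^term>\<open>poly p s + exp (- s) * poly q s\<close>; this representation exists and is unique.
\<close>

definition p_poly :: "nat \<Rightarrow> real \<Rightarrow> real \<Rightarrow> (real \<Rightarrow> real) \<Rightarrow> complex poly" where
  "p_poly n \<mu> \<pi>0 f = (THE p. \<exists>q. \<forall>s.
     - exp (- s) * s * (of_real \<mu> + s) ^ n * A n \<mu> \<pi>0 f (- s) - of_real \<mu> ^ n * A n \<mu> \<pi>0 f s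
     = poly p s + exp (- s) * poly q s)"

definition R_poly :: "nat \<Rightarrow> real \<Rightarrow> complex poly" where
  "R_poly n \<mu> = [:0, 1:] ^ 2 * ([:of_real \<mu> ^ 2:] - [:0, 1:] ^ 2) ^ n + [:of_real \<mu> ^ (2 * n):]"

lemma poly_R_poly:
  "poly (R_poly n \<mu>) s = s ^ 2 * (of_real \<mu> ^ 2 - s ^ 2) ^ n + of_real \<mu> ^ (2 * n)"
  by (simp add: R_poly_def)

definition coef :: "nat \<Rightarrow> real \<Rightarrow> real \<Rightarrow> (real \<Rightarrow> real) \<Rightarrow> complex \<Rightarrow> complex" where
  "coef n \<mu> \<pi>0 f \<rho> = poly (p_poly n \<mu> \<pi>0 f) \<rho> / poly (pderiv (R_poly n \<mu>)) \<rho>"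

text \<open>
  The family \<^term>\<open>r\<close>, indexed by 1 to 2n+2, lists the zeros of \<^term>\<open>R_poly n \<mu>\<close> with multiplicity, so that
  their simplicity is not built in.
\<close>

definition lists_zeros :: "nat \<Rightarrow> real \<Rightarrow> (nat \<Rightarrow> complex) \<Rightarrow> bool" where
  "lists_zeros n \<mu> r \<longleftrightarrow>
     R_poly n \<mu> = smult (lead_coeff (R_poly n \<mu>)) (\<Prod>i\<in>{1..2 * n + 2}. [:- r i, 1:])"

end

theory Submission
  imports Defs
begin

text \<open>
  The density is found by a Laplace transform on \<open>[0, 1]\<close>. The equation for the
  density expresses the reflected density \<open>f (1 - x)\<close> as the convolution of the Erlang distribution
  function with the law of the waiting time, so its transform links the values at \<open>s\<close> and \<open>- s\<close>: the
  Erlang distribution function has the rational transform \<open>\<mu>^n / (s (\<mu> + s)^n)\<close>, and cutting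
  the integrals off at the end of the interval only adds an exponential times a polynomial
  (\<open>truncated_transform_erlang_G\<close>, \<open>half_transform_equation\<close>). Eliminating the value at
  \<open>- s\<close> gives \<open>\<phi> R = p + exp (- s) q\<close> (\<open>transform_equation\<close>, \<open>exp_part_decomposition\<close>), where the
  polynomials are unique because the exponential is periodic (\<open>poly_add_exp_poly_eq_0\<close>) and both
  have degree below \<open>2 n + 2\<close>.

  The transform of \<open>exp (r x)\<close> on \<open>[0, 1]\<close> is \<open>(1 - exp (r - s)) / (s - r)\<close>. The partial fraction
  expansion of \<open>p / R\<close> at the simple zeros of \<open>R\<close> therefore produces the transform of
  \<open>\<Sum>i. c i * exp (r i * x)\<close>, except that the terms with \<open>exp (- s)\<close> must fit as well. They do: \<open>\<phi>\<close> has no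
  poles, which forces \<open>q (r i) = - exp (r i) * p (r i)\<close> (\<open>density_eq_sum_exp\<close>). A continuous function
  on \<open>[0, 1]\<close> is determined by its transform, since the derivatives at \<open>0\<close> are its moments
  (\<open>unit_transform_zero_imp_zero\<close>), and the density is continuous by its integral equation
  (\<open>density_continuous\<close>). So the two functions agree at every point, and the formula for the atom
  follows by integrating the density, as the total mass is \<open>1\<close>.
\<close>

section \<open>The Erlang distribution function\<close>

text \<open>
  The derivatives of the successive terms telescope, so only the last one survives.
\<close>

lemma exp_partial_sum_has_field_derivative:
  fixes a u :: "'a :: {real_normed_field, banach}"
  shows "((\<lambda>u. exp (- a * u) * (\<Sum>i\<le>j. (a * u) ^ i / fact i)) has_field_derivative
           - a * exp (- a * u) * (a * u) ^ j / fact j) (at u)"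
proof (induction j)
  case 0
  show ?case by (auto intro!: derivative_eq_intros)
next
  case (Suc j)
  have "((\<lambda>u. (a * u) ^ Suc j) has_field_derivative of_nat (Suc j) * (a * (a * u) ^ j)) (at u)"
    by (rule DERIV_power_Suc[THEN DERIV_cong]) (auto intro!: derivative_eq_intros simp: algebra_simps)
  from DERIV_cdivide[OF this, of "fact (Suc j)"]
  have pow: "((\<lambda>u. (a * u) ^ Suc j / fact (Suc j)) has_field_derivative a * (a * u) ^ j / fact j) (at u)"
    by (simp del: of_nat_Suc power_Suc)
  have "((\<lambda>u. exp (- a * u)) has_field_derivative - a * exp (- a * u)) (at u)"
    by (auto intro!: derivative_eq_intros)
  from DERIV_mult[OF this pow]
  have "((\<lambda>u. exp (- a * u) * ((a * u) ^ Suc j / fact (Suc j))) has_field_derivative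
     - a * exp (- a * u) * ((a * u) ^ Suc j / fact (Suc j)) + a * exp (- a * u) * (a * u) ^ j / fact j) (at u)"
    by (simp add: mult_ac)
  from DERIV_add[OF Suc.IH this] show ?case
    by (simp add: algebra_simps)
qed

lemma erlang_G_eq_max:
  assumes "n \<ge> 1"
  shows "erlang_G n \<mu> x = 1 - exp (- \<mu> * max 0 x) * (\<Sum>j<n. (\<mu> * max 0 x) ^ j / fact j)"
proof -
  have "(\<Sum>j<n. (0::real) ^ j / fact j) = 1"
    using assms by (subst sum.remove[of _ 0]) (auto intro!: sum.neutral)
  then show ?thesis by (auto simp: erlang_G_def max_def)
qed

lemma continuous_erlang_G:
  assumes "n \<ge> 1"
  shows "continuous_on S (erlang_G n \<mu>)"
  unfolding erlang_G_eq_max[OF assms] by (intro continuous_intros) auto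

lemma erlang_G_nonpos [simp]: "n \<ge> 1 \<Longrightarrow> x \<le> 0 \<Longrightarrow> erlang_G n \<mu> x = 0"
  using erlang_G_eq_max[of n \<mu> x] erlang_G_eq_max[of n \<mu> "-1"]
  by (simp add: erlang_G_def max_def)

text \<open>
  Since \<^term>\<open>erlang_G n \<mu>\<close> vanishes on the negative half-line, the upper limit \<open>1 - x\<close> of the integral
  may be replaced by \<open>1\<close>. The point \<open>x\<close> then enters only through the continuous kernel, and
  integrability of the density suffices for dominated convergence.
\<close>

lemma density_continuous:
  assumes n: "n \<ge> 1" and int: "set_integrable lborel {0..1} f"
    and eq: "density_equation (erlang_G n \<mu>) \<pi>0 f"
  shows "continuous_on {0..1} f"
proof -
  define G where "G = erlang_G n \<mu>"
  have G: "isCont G x" for x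
    using continuous_erlang_G[OF n, of UNIV] by (simp add: G_def continuous_on_eq_continuous_at)
  have [measurable]: "G \<in> borel_measurable borel"
    unfolding G_def by (intro borel_measurable_continuous_onI continuous_erlang_G n)
  have "bounded (G ` {-1..1})"
    unfolding G_def by (intro compact_imp_bounded compact_continuous_image continuous_erlang_G n compact_Icc)
  then have "\<exists>C. \<forall>y\<in>{-1..1}. \<bar>G y\<bar> \<le> C"
    by (simp add: bounded_iff)
  then obtain C where C: "\<And>y. y \<in> {-1..1} \<Longrightarrow> \<bar>G y\<bar> \<le> C"
    by blast
  define f0 where "f0 z = indicator {0..1} z * f z" for z :: real
  have f0: "integrable lborel f0"
    using int by (simp add: set_integrable_def f0_def[abs_def])
  have f_eq: "f x = \<pi>0 * G (1 - x) + (LBINT z. G (1 - x - z) * f0 z)" if "x \<in> {0..1}" for x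
  proof -
    have "(LBINT z:{0..1 - x}. G (1 - x - z) * f z) = (LBINT z. G (1 - x - z) * f0 z)"
      unfolding set_lebesgue_integral_def using that n
      by (intro Bochner_Integration.integral_cong refl) (auto simp: f0_def G_def indicator_def)
    then show ?thesis
      using eq that unfolding density_equation_def G_def by auto
  qed
  have "continuous_on {0..1} (\<lambda>x. \<pi>0 * G (1 - x) + (LBINT z. G (1 - x - z) * f0 z))"
    unfolding continuous_on_sequentially comp_def
  proof (intro ballI allI impI, elim conjE)
    fix X :: "nat \<Rightarrow> real" and x assume x: "x \<in> {0..1}" "\<forall>k. X k \<in> {0..1}" "X \<longlonglongrightarrow> x"
    have lim: "(\<lambda>k. G (1 - X k - z)) \<longlonglongrightarrow> G (1 - x - z)" for z
      by (intro isCont_tendsto_compose[OF G] tendsto_intros x)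
    have "(\<lambda>k. LBINT z. G (1 - X k - z) * f0 z) \<longlonglongrightarrow> (LBINT z. G (1 - x - z) * f0 z)"
    proof (rule integral_dominated_convergence[where w = "\<lambda>z. C * \<bar>f0 z\<bar>"])
      show "AE z in lborel. norm (G (1 - X k - z) * f0 z) \<le> C * \<bar>f0 z\<bar>" for k
      proof (rule AE_I2)
        fix z :: real
        have "\<bar>G (1 - X k - z)\<bar> \<le> C" if "z \<in> {0..1}"
          using that x(2)[rule_format, of k] by (intro C) auto
        then show "norm (G (1 - X k - z) * f0 z) \<le> C * \<bar>f0 z\<bar>"
          by (cases "z \<in> {0..1}") (auto simp: f0_def abs_mult intro!: mult_right_mono)
      qed
    qed (use f0 lim in \<open>auto intro!: tendsto_intros\<close>)
    moreover have "(\<lambda>k. G (1 - X k)) \<longlonglongrightarrow> G (1 - x)"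
      using lim[of 0] by simp
    ultimately show "(\<lambda>k. \<pi>0 * G (1 - X k) + (LBINT z. G (1 - X k - z) * f0 z)) \<longlonglongrightarrow>
        \<pi>0 * G (1 - x) + (LBINT z. G (1 - x - z) * f0 z)"
      by (intro tendsto_intros)
  qed
  then show ?thesis
    by (rule continuous_on_eq) (use f_eq in auto)
qed

text \<open>
  The constants in \<^const>\<open>A\<close> come from this closed form. Multiplying by \<open>s (\<mu> - s)^n\<close> clears the
  denominators of the Laplace transform of the Erlang distribution function; what remains beyond
  its two main terms is the tail cut off at \<open>t\<close>, an exponential times a polynomial in \<open>t\<close>. In this
  form there is no exception at \<open>s = 0\<close> and \<open>s = \<mu>\<close>, so the identity can later be evaluated at every
  complex number.
\<close>

lemma truncated_transform_erlang_G:
  fixes s :: complex and t \<mu> :: real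
  assumes n: "n \<ge> 1" and t: "0 \<le> t" "t \<le> 1"
  shows "s * (of_real \<mu> - s) ^ n *
           integral {0..1} (\<lambda>x. exp (- s * of_real x) * of_real (erlang_G n \<mu> (t - x))) =
         (of_real \<mu> - s) ^ n - of_real \<mu> ^ n * exp (- s * of_real t)
         + exp (- of_real \<mu> * of_real t) * (\<Sum>j<n. \<Sum>i\<le>j.
             s * of_real \<mu> ^ j * (of_real \<mu> - s) ^ (n - j - 1 + i) / fact i * of_real t ^ i)"
proof -
  define m where "m = complex_of_real \<mu>"
  define a where "a = m - s"
  define S where "S u = (\<Sum>j<n. \<Sum>i\<le>j. s * m ^ j * a ^ (n - j - 1 + i) / fact i * u ^ i)" for u :: complex
  \<comment> \<open>Up to the factor \<open>exp (- s * t)\<close>, \<open>x \<mapsto> - L (t - x)\<close> is an antiderivative of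
    \<open>s * a ^ n\<close> times the integrand.\<close>
  define L where "L u = a ^ n * exp (s * u) - m ^ n + exp (- a * u) * S u" for u :: complex
  have S_eq: "exp (- a * u) * S u =
      (\<Sum>j<n. s * m ^ j * a ^ (n - j - 1) * (exp (- a * u) * (\<Sum>i\<le>j. (a * u) ^ i / fact i)))" for u
    unfolding S_def sum_distrib_left power_add power_mult_distrib
    by (intro sum.cong refl) simp
  have L_deriv: "(L has_field_derivative
      s * a ^ n * exp (s * u) * (1 - exp (- m * u) * (\<Sum>j<n. (m * u) ^ j / fact j))) (at u)" for u
  proof -
    have "((\<lambda>u. exp (- a * u) * S u) has_field_derivative
       (\<Sum>j<n. s * m ^ j * a ^ (n - j - 1) * (- a * exp (- a * u) * (a * u) ^ j / fact j))) (at u)"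
      unfolding S_eq by (intro DERIV_sum DERIV_cmult exp_partial_sum_has_field_derivative)
    also have "(\<Sum>j<n. s * m ^ j * a ^ (n - j - 1) * (- a * exp (- a * u) * (a * u) ^ j / fact j)) =
      (\<Sum>j<n. - s * a ^ n * exp (- a * u) * ((m * u) ^ j / fact j))"
    proof (intro sum.cong refl)
      fix j assume "j \<in> {..<n}"
      then have "a ^ n = a ^ (n - j - 1) * a * a ^ j"
        by (simp flip: power_Suc power_Suc2 power_add)
      then show "s * m ^ j * a ^ (n - j - 1) * (- a * exp (- a * u) * (a * u) ^ j / fact j) =
        - s * a ^ n * exp (- a * u) * ((m * u) ^ j / fact j)"
        by (simp add: power_mult_distrib)
    qed
    also have "exp (- a * u) = exp (s * u) * exp (- m * u)"
      by (simp add: a_def algebra_simps flip: exp_add)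
    finally have *: "((\<lambda>u. exp (- a * u) * S u) has_field_derivative
      (\<Sum>j<n. - s * a ^ n * (exp (s * u) * exp (- m * u)) * ((m * u) ^ j / fact j))) (at u)" .
    have "((\<lambda>u. a ^ n * exp (s * u) - m ^ n) has_field_derivative s * a ^ n * exp (s * u)) (at u)"
      by (auto intro!: derivative_eq_intros)
    from DERIV_add[OF this *] show ?thesis
      unfolding L_def[abs_def] by (simp add: sum_distrib_left algebra_simps sum_negf)
  qed
  \<comment> \<open>At 0 only the terms with \<open>i = 0\<close> remain. As \<open>s = m - a\<close>, they sum up to \<open>m ^ n - a ^ n\<close>.\<close>
  have L0: "L 0 = 0"
  proof -
    have "S 0 = (\<Sum>j<n. (\<Sum>i\<le>j. if i = 0 then s * m ^ j * a ^ (n - j - 1) else 0))"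
      unfolding S_def by (intro sum.cong refl) auto
    also have "\<dots> = (m - a) * (\<Sum>j<n. a ^ (n - Suc j) * m ^ j)"
      by (simp add: a_def sum_distrib_left mult_ac)
    also have "\<dots> = m ^ n - a ^ n"
      by (simp add: power_diff_sumr2)
    finally show ?thesis by (simp add: L_def)
  qed
  have "((\<lambda>x. s * a ^ n * (exp (- s * of_real x) * of_real (erlang_G n \<mu> (t - x)))) has_integral
     (- exp (- s * of_real t) * L (of_real t - of_real t)) - (- exp (- s * of_real t) * L (of_real t - of_real 0))) {0..t}"
  proof (rule fundamental_theorem_of_calculus[OF t(1)])
    fix x assume x: "x \<in> {0..t}"
    define u where "u = complex_of_real t - of_real x"
    have "((\<lambda>x. - exp (- s * of_real t) * L (of_real t - x)) has_field_derivative
       exp (- s * of_real t) * (s * a ^ n * exp (s * u) * (1 - exp (- m * u) * (\<Sum>j<n. (m * u) ^ j / fact j))))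
       (at (of_real x))"
      unfolding u_def by (auto intro!: derivative_eq_intros DERIV_chain2[OF L_deriv])
    also have "exp (- s * of_real t) * (s * a ^ n * exp (s * u) * (1 - exp (- m * u) * (\<Sum>j<n. (m * u) ^ j / fact j)))
      = s * a ^ n * (exp (- s * of_real x) * of_real (erlang_G n \<mu> (t - x)))"
    proof -
      have "exp (- s * of_real t) * exp (s * u) = exp (- s * of_real x)"
        by (simp add: u_def algebra_simps flip: exp_add)
      moreover have "1 - exp (- m * u) * (\<Sum>j<n. (m * u) ^ j / fact j) = of_real (erlang_G n \<mu> (t - x))"
        using x by (simp add: u_def m_def erlang_G_def flip: exp_of_real)
      ultimately show ?thesis by (simp add: mult_ac)
    qed
    finally show "((\<lambda>x. - exp (- s * of_real t) * L (of_real t - of_real x)) has_vector_derivative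
        s * a ^ n * (exp (- s * of_real x) * of_real (erlang_G n \<mu> (t - x)))) (at x within {0..t})"
      by (rule has_vector_derivative_real_field)
  qed
  then have "((\<lambda>x. s * a ^ n * (exp (- s * of_real x) * of_real (erlang_G n \<mu> (t - x)))) has_integral
     exp (- s * of_real t) * L (of_real t)) {0..t}"
    by (simp add: L0)
  then have "((\<lambda>x. if x \<in> {0..t} then s * a ^ n * (exp (- s * of_real x) * of_real (erlang_G n \<mu> (t - x))) else 0)
     has_integral exp (- s * of_real t) * L (of_real t)) {0..1}"
    by (subst has_integral_restrict) (use t in auto)
  then have "((\<lambda>x. s * a ^ n * (exp (- s * of_real x) * of_real (erlang_G n \<mu> (t - x)))) has_integral
     exp (- s * of_real t) * L (of_real t)) {0..1}"
    by (rule has_integral_eq[rotated]) (use n in auto)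
  then have "s * a ^ n * integral {0..1} (\<lambda>x. exp (- s * of_real x) * of_real (erlang_G n \<mu> (t - x)))
    = exp (- s * of_real t) * L (of_real t)"
    by (metis integral_mult_right integral_unique)
  also have "\<dots> = a ^ n - m ^ n * exp (- s * of_real t) + exp (- m * of_real t) * S (of_real t)"
    by (simp add: L_def a_def algebra_simps flip: exp_add)
  finally show ?thesis
    by (simp add: S_def a_def m_def)
qed

section \<open>Laplace transforms on the unit interval\<close>

text \<open>
  The gauge integral is used because its theorems on differentiating under the integral sign and on
  exchanging two integrals ask only for continuity.
\<close>

definition unit_transform :: "(real \<Rightarrow> complex) \<Rightarrow> complex \<Rightarrow> complex" where
  "unit_transform h s = integral {0..1} (\<lambda>x. exp (- s * of_real x) * h x)"

lemma \<phi>_eq_unit_transform: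
  assumes "continuous_on {0..1} f"
  shows "\<phi> f = unit_transform (\<lambda>x. of_real (f x))"
proof
  fix s
  have "set_integrable lborel {0..1} (\<lambda>x. exp (- s * of_real x) * complex_of_real (f x))"
    by (intro borel_integrable_atLeastAtMost' continuous_intros assms)
  then show "\<phi> f s = unit_transform (\<lambda>x. of_real (f x)) s"
    by (simp add: \<phi>_def unit_transform_def set_borel_integral_eq_integral)
qed

lemma unit_transform_has_field_derivative:
  assumes "continuous_on {0..1} h"
  shows "(unit_transform h has_field_derivative unit_transform (\<lambda>x. - of_real x * h x) s) (at s)"
proof -
  have "((\<lambda>s. integral (cbox 0 1) (\<lambda>x::real. exp (- s * of_real x) * h x)) has_field_derivative
      integral (cbox 0 1) (\<lambda>x. exp (- s * of_real x) * (- of_real x * h x))) (at s within UNIV)"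
  proof (rule leibniz_rule_field_derivative)
    fix s :: complex and x :: real
    show "((\<lambda>s. exp (- s * of_real x) * h x) has_field_derivative
        exp (- s * of_real x) * (- of_real x * h x)) (at s within UNIV)"
      by (auto intro!: derivative_eq_intros)
    show "(\<lambda>x. exp (- s * of_real x) * h x) integrable_on cbox 0 1"
      by (intro integrable_continuous continuous_intros) (use assms in simp)
  next
    have "continuous_on (UNIV \<times> {0..1}) (\<lambda>p. h (snd p))"
      by (rule continuous_on_compose2[OF assms]) (auto intro!: continuous_intros)
    then show "continuous_on (UNIV \<times> cbox 0 1) (\<lambda>(s, x). exp (- s * of_real x) * (- of_real x * h x))"
      unfolding case_prod_unfold by (intro continuous_intros) simp
  qed auto
  then show ?thesis
    by (simp add: unit_transform_def[abs_def])
qed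

lemma higher_deriv_unit_transform:
  assumes "continuous_on {0..1} h"
  shows "(deriv ^^ l) (unit_transform h) = unit_transform (\<lambda>x. (- of_real x) ^ l * h x)"
  using assms
proof (induction l arbitrary: h)
  case (Suc l)
  have "deriv (unit_transform h) = unit_transform (\<lambda>x. - of_real x * h x)"
    using unit_transform_has_field_derivative[OF Suc.prems] by (auto intro!: DERIV_imp_deriv)
  moreover have "continuous_on {0..1} (\<lambda>x. - of_real x * h x)"
    by (intro continuous_intros Suc.prems)
  ultimately show ?case
    by (simp only: funpow_Suc_right comp_apply Suc.IH power_Suc mult.assoc mult.left_commute)
qed simp

text \<open>
  By Weierstrass \<open>u\<close> is a uniform limit of polynomials, all of which are orthogonal to \<open>u\<close>. Hence \<open>u\<close>
  is orthogonal to itself.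
\<close>

lemma continuous_moments_zero_imp_zero:
  fixes u :: "real \<Rightarrow> real"
  assumes u: "continuous_on {0..1} u"
    and moments: "\<And>l. integral {0..1} (\<lambda>x. x ^ l * u x) = 0"
    and x: "x \<in> {0..1}"
  shows "u x = 0"
proof -
  have poly_zero: "integral {0..1} (\<lambda>x. g x * u x) = 0" if g: "real_polynomial_function g" for g
  proof -
    obtain a N where "g = (\<lambda>x. \<Sum>i\<le>N. a i * x ^ i)"
      using g by (auto simp: real_polynomial_function_iff_sum)
    then have "integral {0..1} (\<lambda>x. g x * u x) = integral {0..1} (\<lambda>x. \<Sum>i\<le>N. a i * (x ^ i * u x))"
      by (simp add: sum_distrib_right mult.assoc)
    also have "\<dots> = (\<Sum>i\<le>N. integral {0..1} (\<lambda>x. a i * (x ^ i * u x)))"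
      by (rule integral_sum) (auto intro!: integrable_continuous_interval continuous_intros u)
    finally show ?thesis
      by (simp add: moments)
  qed
  define I where "I = integral {0..1} (\<lambda>x. u x * u x)"
  have "bounded (u ` {0..1})"
    by (intro compact_imp_bounded compact_continuous_image u compact_Icc)
  then obtain C where "C > 0" and C: "\<And>x. x \<in> {0..1} \<Longrightarrow> \<bar>u x\<bar> \<le> C"
    by (auto simp: bounded_pos)
  have "I \<le> 0 + e" if "e > 0" for e
  proof -
    obtain g where g: "real_polynomial_function g" "\<And>x. x \<in> {0..1} \<Longrightarrow> \<bar>u x - g x\<bar> < e / C"
      using Stone_Weierstrass_real_polynomial_function[OF compact_Icc u, of "e / C"] \<open>e > 0\<close> \<open>C > 0\<close>
      by auto
    have cont_g: "continuous_on {0..1} g"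
      using g(1) by (simp add: continuous_on_polymonial_function real_polynomial_function_eq)
    have "I = integral {0..1} (\<lambda>x. u x * u x) - integral {0..1} (\<lambda>x. g x * u x)"
      using poly_zero[OF g(1)] by (simp add: I_def)
    also have "\<dots> = integral {0..1} (\<lambda>x. u x * u x - g x * u x)"
      by (rule integral_diff[symmetric])
        (auto intro!: integrable_continuous_interval continuous_intros u cont_g)
    also have "\<dots> \<le> integral {0..1} (\<lambda>x::real. e)"
    proof (rule integral_le)
      fix x :: real assume x: "x \<in> {0..1}"
      have "u x * u x - g x * u x \<le> \<bar>u x - g x\<bar> * \<bar>u x\<bar>"
        by (metis abs_ge_self abs_mult left_diff_distrib)
      also have "\<dots> \<le> e / C * C"
        using g(2)[OF x] C[OF x] by (intro mult_mono) auto
      finally show "u x * u x - g x * u x \<le> e"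
        using \<open>C > 0\<close> by simp
    qed (auto intro!: integrable_continuous_interval continuous_intros u cont_g)
    finally show ?thesis by simp
  qed
  then have "I \<le> 0"
    by (rule field_le_epsilon)
  moreover have "I \<ge> 0"
    unfolding I_def by (intro integral_nonneg integrable_continuous_interval continuous_intros u) auto
  ultimately have "I = 0" by simp
  then have "\<forall>x\<in>{0..1}. u x * u x = 0"
    unfolding I_def by (subst (asm) integral_eq_0_iff) (auto intro!: continuous_intros u)
  with x show ?thesis by auto
qed

text \<open>
  The derivatives of the transform at \<open>0\<close> are, up to sign, the moments of \<open>h\<close>.
\<close>

lemma unit_transform_zero_imp_zero:
  assumes h: "continuous_on {0..1} h" and zero: "\<And>s. unit_transform h s = 0" and x: "x \<in> {0..1}"
  shows "h x = 0"
proof -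
  have moments: "integral {0..1} (\<lambda>x. of_real (x ^ l) * h x) = 0" for l
  proof -
    have "unit_transform h = (\<lambda>_. 0)"
      using zero by auto
    then have "(deriv ^^ l) (unit_transform h) = (\<lambda>_. 0)"
      by (induction l) auto
    then have "unit_transform (\<lambda>x. (- of_real x) ^ l * h x) 0 = 0"
      by (simp add: higher_deriv_unit_transform[OF h])
    then have "integral {0..1} (\<lambda>x. (-1) ^ l * (of_real (x ^ l) * h x)) = 0"
      by (simp add: unit_transform_def power_minus[of "complex_of_real _"] mult_ac)
    then show ?thesis
      by (subst (asm) integral_mult_right) simp
  qed
  have int: "(\<lambda>x. of_real (x ^ l) * h x) integrable_on {0..1}" for l
    by (intro integrable_continuous_interval continuous_intros h)
  have "Re (h x) = 0"
  proof (rule continuous_moments_zero_imp_zero[OF _ _ x])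
    show "integral {0..1} (\<lambda>x. x ^ l * Re (h x)) = 0" for l
      using integral_linear[OF int bounded_linear_Re, of l] moments[of l] by (simp add: comp_def del: of_real_power)
  qed (intro continuous_intros h)
  moreover have "Im (h x) = 0"
  proof (rule continuous_moments_zero_imp_zero[OF _ _ x])
    show "integral {0..1} (\<lambda>x. x ^ l * Im (h x)) = 0" for l
      using integral_linear[OF int bounded_linear_Im, of l] moments[of l] by (simp add: comp_def del: of_real_power)
  qed (intro continuous_intros h)
  ultimately show ?thesis
    by (simp add: complex_eq_iff)
qed

text \<open>
  Stated without division, so that it also covers \<open>s = r\<close>, where the transform of the exponential
  has a removable singularity.
\<close>

lemma unit_transform_exp:
  "(s - r) * unit_transform (\<lambda>x. exp (r * of_real x)) s = 1 - exp r * exp (- s)"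
proof -
  have "((\<lambda>x. (s - r) * (exp (- s * of_real x) * exp (r * of_real x))) has_integral
      (- exp ((r - s) * of_real 1)) - (- exp ((r - s) * of_real 0))) {0..1}"
  proof (rule fundamental_theorem_of_calculus)
    fix x :: real
    have "((\<lambda>x. - exp ((r - s) * x)) has_field_derivative
        (s - r) * (exp (- s * of_real x) * exp (r * of_real x))) (at (of_real x))"
      by (auto intro!: derivative_eq_intros simp: algebra_simps simp flip: exp_add)
    then show "((\<lambda>x. - exp ((r - s) * of_real x)) has_vector_derivative
        (s - r) * (exp (- s * of_real x) * exp (r * of_real x))) (at x within {0..1})"
      by (rule has_vector_derivative_real_field)
  qed simp
  from integral_unique[OF this] show ?thesis
    by (simp add: unit_transform_def diff_conv_add_uminus exp_add del: add_uminus_conv_diff)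
qed

lemma unit_transform_sum:
  assumes "finite I" "\<And>i. i \<in> I \<Longrightarrow> continuous_on {0..1} (h i)"
  shows "unit_transform (\<lambda>x. \<Sum>i\<in>I. c i * h i x) s = (\<Sum>i\<in>I. c i * unit_transform (h i) s)"
proof -
  have "unit_transform (\<lambda>x. \<Sum>i\<in>I. c i * h i x) s =
      integral {0..1} (\<lambda>x. \<Sum>i\<in>I. c i * (exp (- s * of_real x) * h i x))"
    by (simp add: unit_transform_def sum_distrib_left mult_ac)
  also have "\<dots> = (\<Sum>i\<in>I. integral {0..1} (\<lambda>x. c i * (exp (- s * of_real x) * h i x)))"
    by (rule integral_sum)
      (use assms in \<open>auto intro!: integrable_continuous_interval continuous_intros\<close>)
  finally show ?thesis
    by (simp add: unit_transform_def)
qed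

section \<open>Exponential polynomials and interpolation\<close>

text \<open>
  The exponential has period \<open>2 \<pi> \<i>\<close>: along a progression with this step the factor \<open>exp (- s)\<close> is a
  constant \<open>c\<close>, and the polynomial \<open>p + c q\<close> has infinitely many zeros. The two values \<open>c = 1\<close> and
  \<open>c = -1\<close> separate \<open>p\<close> from \<open>q\<close>.
\<close>

lemma poly_add_exp_poly_eq_0:
  fixes p q :: "complex poly"
  assumes "\<And>s. poly p s + exp (- s) * poly q s = 0"
  shows "p = 0" "q = 0"
proof -
  have "p + smult (exp (- s)) q = 0" for s
  proof (rule ccontr)
    assume "p + smult (exp (- s)) q \<noteq> 0"
    then have "finite {t. poly (p + smult (exp (- s)) q) t = 0}"
      by (rule poly_roots_finite)
    moreover have "range (\<lambda>k::nat. s + 2 * of_nat k * of_real pi * \<i>) \<subseteq> {t. poly (p + smult (exp (- s)) q) t = 0}"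
    proof safe
      fix k :: nat
      have "exp (- s) = exp (- (s + 2 * of_nat k * of_real pi * \<i>))"
        unfolding exp_eq by (rule exI[of _ "int k"]) simp
      with assms[of "s + 2 * of_nat k * of_real pi * \<i>"]
      show "poly (p + smult (exp (- s)) q) (s + 2 * of_nat k * of_real pi * \<i>) = 0"
        by simp
    qed
    moreover have "inj (\<lambda>k::nat. s + 2 * of_nat k * of_real pi * \<i>)"
      by (auto simp: inj_def)
    ultimately show False
      using finite_subset finite_imageD infinite_UNIV_nat by blast
  qed
  from this[of 0] this[of "of_real pi * \<i>"] have "p + q = 0" "p - q = 0"
    by (simp_all add: exp_minus exp_pi_i)
  then show "p = 0" "q = 0"
    by (auto simp: poly_eq_iff add_eq_0_iff2)
qed

text \<open>
  Lagrange interpolation in the form of a partial fraction expansion of \<open>p / Q\<close>: at a simple zero of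
  \<open>Q\<close>, the cofactor of the linear factor takes the value of the derivative of \<open>Q\<close>.
\<close>

lemma interpolation_at_simple_roots:
  fixes p Q :: "'a :: field poly" and r :: "'b \<Rightarrow> 'a"
  assumes r: "inj_on r I" and deg: "degree p < card I" "degree Q = card I"
    and Q: "\<And>i. i \<in> I \<Longrightarrow> Q = [:- r i, 1:] * q i"
    and simple: "\<And>i. i \<in> I \<Longrightarrow> poly (pderiv Q) (r i) \<noteq> 0"
  shows "p = (\<Sum>i\<in>I. smult (poly p (r i) / poly (pderiv Q) (r i)) (q i))"
proof (rule poly_eqI_degree[where A = "r ` I"])
  have fin: "finite I"
    using deg by (metis card.infinite not_less_zero)
  have card: "card (r ` I) = card I"
    by (rule card_image[OF r])
  show "degree p < card (r ` I)"
    using deg card by simp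
  have deg_q: "degree (q i) < card I" if "i \<in> I" for i
  proof -
    have "q i \<noteq> 0"
      using Q[OF that] deg by auto
    then have "degree Q = 1 + degree (q i)"
      by (subst Q[OF that], subst degree_mult_eq) auto
    then show ?thesis using deg by simp
  qed
  have "degree (\<Sum>i\<in>I. smult (poly p (r i) / poly (pderiv Q) (r i)) (q i)) < card I"
    by (rule degree_sum_less) (use deg deg_q in \<open>auto intro: le_less_trans[OF degree_smult_le]\<close>)
  then show "degree (\<Sum>i\<in>I. smult (poly p (r i) / poly (pderiv Q) (r i)) (q i)) < card (r ` I)"
    by (simp add: card)
  fix x assume "x \<in> r ` I"
  then obtain k where k: "k \<in> I" "x = r k" by auto
  have root: "poly Q (r k) = 0"
    by (subst Q[OF k(1)]) simp
  have off: "poly (q i) (r k) = 0" if "i \<in> I" "i \<noteq> k" for i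
  proof -
    have "r k \<noteq> r i"
      using r that k by (auto dest: inj_onD)
    moreover have "poly Q (r k) = (r k - r i) * poly (q i) (r k)"
      by (subst Q[OF that(1)]) (simp add: algebra_simps)
    ultimately show ?thesis
      using root by simp
  qed
  have on: "poly (q k) (r k) = poly (pderiv Q) (r k)"
    using arg_cong[OF Q[OF k(1)], of "\<lambda>p. poly (pderiv p) (r k)"]
    by (simp add: pderiv_mult pderiv_pCons del: mult_pCons_left)
  have "(\<Sum>i\<in>I. poly p (r i) / poly (pderiv Q) (r i) * poly (q i) (r k)) =
      poly p (r k) / poly (pderiv Q) (r k) * poly (q k) (r k)"
    using fin k off by (subst sum.remove[of _ k]) (auto intro!: sum.neutral)
  also have "\<dots> = poly p (r k)"
    using simple[OF k(1)] by (simp add: on)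
  finally show "poly p x = poly (\<Sum>i\<in>I. smult (poly p (r i) / poly (pderiv Q) (r i)) (q i)) x"
    by (simp add: k poly_sum)
qed

section \<open>The transform equation\<close>

text \<open>
  The double and the triple sum in \<^const>\<open>A\<close> have the same coefficients; collecting them leaves one
  polynomial in \<open>s\<close>, whose coefficients depend on the unknown constants only through these weights.
\<close>

definition boundary_weight :: "real \<Rightarrow> real \<Rightarrow> (real \<Rightarrow> real) \<Rightarrow> nat \<Rightarrow> complex" where
  "boundary_weight \<mu> \<pi>0 f i =
     of_real \<pi>0 + (\<Sum>l\<le>i. of_nat (i choose l) * (deriv ^^ l) (\<phi> f) (- of_real \<mu>))"

definition boundary_poly :: "nat \<Rightarrow> real \<Rightarrow> (nat \<Rightarrow> complex) \<Rightarrow> complex poly" where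
  "boundary_poly n \<mu> w = (\<Sum>j<n. \<Sum>i\<le>j.
     smult (of_real \<mu> ^ j / fact i * w i) ([:0, 1:] * [:of_real \<mu>, 1:] ^ (n - j - 1 + i)))"

lemma poly_boundary_poly:
  "poly (boundary_poly n \<mu> w) s = (\<Sum>j<n. \<Sum>i\<le>j.
     s * of_real \<mu> ^ j * (of_real \<mu> + s) ^ (n - j - 1 + i) / fact i * w i)"
  unfolding boundary_poly_def poly_sum by (intro sum.cong refl) (simp add: mult_ac)

lemma A_eq_boundary_poly:
  "A n \<mu> \<pi>0 f s = of_real \<pi>0 * of_real \<mu> ^ n - exp (- s) * (of_real \<mu> + s) ^ n
     + exp (- (of_real \<mu> + s)) * poly (boundary_poly n \<mu> (boundary_weight \<mu> \<pi>0 f)) s"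
proof -
  have "poly (boundary_poly n \<mu> (boundary_weight \<mu> \<pi>0 f)) s =
      of_real \<pi>0 * (\<Sum>j<n. \<Sum>i\<le>j. s * of_real \<mu> ^ j * (of_real \<mu> + s) ^ (n - j - 1 + i) / fact i)
      + (\<Sum>j<n. \<Sum>i\<le>j. \<Sum>l\<le>i.
          of_nat (i choose l) * (s * of_real \<mu> ^ j * (of_real \<mu> + s) ^ (n - j - 1 + i) / fact i)
          * (deriv ^^ l) (\<phi> f) (- of_real \<mu>))"
    unfolding poly_boundary_poly boundary_weight_def sum_distrib_left sum.distrib[symmetric]
    by (intro sum.cong refl) (simp add: sum_distrib_left sum_divide_distrib add_divide_distrib ring_distribs mult_ac)
  then show ?thesis
    unfolding A_def by (simp only: algebra_simps)
qed

text \<open>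
  The exponent of the linear factor is at most \<open>n - 1\<close> because \<open>i \<le> j\<close>. This bound keeps the
  numerator of the transform of lower degree than \<^const>\<open>R_poly\<close>.
\<close>

lemma degree_boundary_poly: "degree (boundary_poly n \<mu> w) \<le> n"
  unfolding boundary_poly_def
proof (intro degree_sum_le finite_lessThan finite_atMost)
  fix j i assume "j \<in> {..<n}" "i \<in> {..j}"
  moreover have "degree ([:0, 1:] * [:complex_of_real \<mu>, 1:] ^ (n - j - 1 + i)) \<le> 1 + (n - j - 1 + i)"
    by (rule order.trans[OF degree_mult_le]) (simp add: degree_power_eq)
  ultimately show "degree (smult (of_real \<mu> ^ j / fact i * w i)
      ([:0, 1:] * [:complex_of_real \<mu>, 1:] ^ (n - j - 1 + i))) \<le> n"
    by (intro order.trans[OF degree_smult_le]) auto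
qed

text \<open>
  Binomial expansion of \<open>(1 - z)^i\<close>, whose powers of \<open>- z\<close> are produced by differentiating the transform.
  In this form the weights arise from the equation for the density.
\<close>

lemma boundary_weight_eq:
  assumes f: "continuous_on {0..1} f"
  shows "boundary_weight \<mu> \<pi>0 f i =
    of_real \<pi>0 + integral {0..1} (\<lambda>z. exp (of_real \<mu> * of_real z) * ((1 - of_real z) ^ i * of_real (f z)))"
proof -
  have "(1 - complex_of_real z) ^ i * of_real (f z) =
      (\<Sum>l\<le>i. of_nat (i choose l) * ((- of_real z) ^ l * of_real (f z)))" for z
    using binomial_ring[of "- complex_of_real z" 1 i]
    by (simp add: sum_distrib_left sum_distrib_right mult_ac)
  moreover have "unit_transform (\<lambda>z. \<Sum>l\<le>i. of_nat (i choose l) * ((- of_real z) ^ l * of_real (f z))) (- of_real \<mu>)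
     = (\<Sum>l\<le>i. of_nat (i choose l) * unit_transform (\<lambda>z. (- of_real z) ^ l * of_real (f z)) (- of_real \<mu>))"
    by (rule unit_transform_sum) (auto intro!: continuous_intros f)
  ultimately show ?thesis
    by (simp add: boundary_weight_def \<phi>_eq_unit_transform[OF f] higher_deriv_unit_transform f
        continuous_on_of_real flip: unit_transform_def)
      (simp add: unit_transform_def)
qed

text \<open>
  Transforming the equation for the density and exchanging the order of integration leaves, for each
  \<open>z\<close>, the transform of \<^term>\<open>erlang_G n \<mu>\<close> truncated to an interval of length \<open>1 - z\<close>. Its three terms,
  integrated against the density, give a multiple of the mass of the density, the transform at the
  reflected point \<open>- s\<close>, and the integrals in the boundary weights. The atom contributes like a mass
  at \<open>z = 0\<close> and completes the first of them to the total mass \<open>1\<close>.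
\<close>

lemma half_transform_equation:
  fixes s :: complex and \<mu> :: real
  assumes n: "n \<ge> 1" and f: "continuous_on {0..1} f"
    and eq: "density_equation (erlang_G n \<mu>) \<pi>0 f"
    and mass: "\<pi>0 + integral {0..1} f = 1"
  shows "s * (of_real \<mu> - s) ^ n * \<phi> f s + of_real \<mu> ^ n * exp (- s) * \<phi> f (- s)
    = - exp (- s) * A n \<mu> \<pi>0 f (- s)"
proof -
  define m where "m = complex_of_real \<mu>"
  define a where "a = m - s"
  define G where "G t = complex_of_real (erlang_G n \<mu> t)" for t
  define F where "F z = complex_of_real (f z)" for z
  define K where "K t = integral {0..1} (\<lambda>x. exp (- s * of_real x) * G (t - x))" for t
  define \<kappa> where "\<kappa> j i = s * m ^ j * a ^ (n - j - 1 + i) / fact i" for j i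
  have G_comp: "continuous_on S (\<lambda>x. G (g x))" if "continuous_on S g" for S and g :: "'b :: topological_space \<Rightarrow> real"
    unfolding G_def
    by (intro continuous_intros continuous_on_compose2[OF continuous_erlang_G[OF n, of UNIV] that subset_UNIV])
  have F: "continuous_on {0..1} F"
    unfolding F_def by (intro continuous_intros f)
  have K: "s * a ^ n * K t = a ^ n - m ^ n * exp (- s * of_real t) +
      exp (- m * of_real t) * (\<Sum>j<n. \<Sum>i\<le>j. \<kappa> j i * of_real t ^ i)" if "t \<in> {0..1}" for t
    using truncated_transform_erlang_G[OF n, of t s \<mu>] that
    by (simp add: K_def G_def a_def m_def \<kappa>_def)
  have F_eq: "F x = of_real \<pi>0 * G (1 - x) + integral {0..1} (\<lambda>z. G (1 - x - z) * F z)"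
    if x: "x \<in> {0..1}" for x
  proof -
    let ?g = "\<lambda>z. erlang_G n \<mu> (1 - x - z) * f z"
    have cont: "continuous_on {0..1} ?g"
      by (intro continuous_intros f continuous_on_compose2[OF continuous_erlang_G[OF n, of UNIV]]) auto
    have "continuous_on {0..1 - x} ?g"
      by (rule continuous_on_subset[OF cont]) (use x in auto)
    then have "(LBINT z:{0..1 - x}. ?g z) = integral {0..1 - x} ?g"
      by (intro set_borel_integral_eq_integral borel_integrable_atLeastAtMost')
    also have "\<dots> = integral {0..1} (\<lambda>z. if z \<in> {0..1 - x} then ?g z else 0)"
    proof -
      have "{0..1 - x} \<inter> {0..1} = {0..1 - x}" using x by auto
      then show ?thesis by (simp only: integral_restrict_Int)
    qed
    also have "\<dots> = integral {0..1} ?g"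
      by (rule Henstock_Kurzweil_Integration.integral_cong) (use n in auto)
    finally have "f x = \<pi>0 * erlang_G n \<mu> (1 - x) + integral {0..1} ?g"
      using eq x by (simp add: density_equation_def)
    moreover have "of_real (integral {0..1} ?g) = integral {0..1} (\<lambda>z. G (1 - x - z) * F z)"
      using integral_linear[OF integrable_continuous_interval[OF cont] bounded_linear_of_real[where 'a = complex]]
      by (simp add: comp_def G_def F_def)
    ultimately show ?thesis
      by (simp add: F_def G_def)
  qed
  have cont2: "continuous_on ({0..1} \<times> {0..1}) (\<lambda>(x, z). exp (- s * of_real x) * (G (1 - x - z) * F z))"
    unfolding case_prod_unfold
    by (intro continuous_intros G_comp continuous_on_compose2[OF F]) auto
  have "\<phi> f s = integral {0..1} (\<lambda>x. exp (- s * of_real x) * F x)"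
    by (simp add: \<phi>_eq_unit_transform[OF f] unit_transform_def F_def)
  also have "\<dots> = integral {0..1} (\<lambda>x. of_real \<pi>0 * (exp (- s * of_real x) * G (1 - x))
      + integral {0..1} (\<lambda>z. exp (- s * of_real x) * (G (1 - x - z) * F z)))"
  proof (rule Henstock_Kurzweil_Integration.integral_cong)
    fix x :: real assume "x \<in> {0..1}"
    then show "exp (- s * of_real x) * F x = of_real \<pi>0 * (exp (- s * of_real x) * G (1 - x))
        + integral {0..1} (\<lambda>z. exp (- s * of_real x) * (G (1 - x - z) * F z))"
      by (subst F_eq) (simp_all only: integral_mult_right, simp add: ring_distribs mult.left_commute)
  qed
  also have "\<dots> = of_real \<pi>0 * K 1
      + integral {0..1} (\<lambda>x. integral {0..1} (\<lambda>z. exp (- s * of_real x) * (G (1 - x - z) * F z)))"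
  proof (subst Henstock_Kurzweil_Integration.integral_add)
    show "(\<lambda>x. integral {0..1} (\<lambda>z. exp (- s * of_real x) * (G (1 - x - z) * F z))) integrable_on {0..1}"
      using integral_continuous_on_param[of "{0..1}" 0 1 "\<lambda>x z. exp (- s * of_real x) * (G (1 - x - z) * F z)"] cont2
      by (intro integrable_continuous_interval) simp
  qed (auto simp: K_def intro!: integrable_continuous_interval continuous_intros G_comp)
  also have "integral {0..1} (\<lambda>x. integral {0..1} (\<lambda>z. exp (- s * of_real x) * (G (1 - x - z) * F z)))
      = integral {0..1} (\<lambda>z. integral {0..1} (\<lambda>x. exp (- s * of_real x) * (G (1 - x - z) * F z)))"
    using integral_swap_continuous[of 0 0 1 1 "\<lambda>x z. exp (- s * of_real x) * (G (1 - x - z) * F z)"] cont2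
    by (simp add: cbox_Pair_eq)
  also have "\<dots> = integral {0..1} (\<lambda>z. F z * K (1 - z))"
    unfolding K_def integral_mult_right[symmetric]
    by (intro Henstock_Kurzweil_Integration.integral_cong) (simp add: mult_ac diff_diff_eq2 algebra_simps)
  finally have "s * a ^ n * \<phi> f s = of_real \<pi>0 * (s * a ^ n * K 1) + integral {0..1} (\<lambda>z. F z * (s * a ^ n * K (1 - z)))"
    by (simp add: algebra_simps flip: integral_mult_right)
  also have "integral {0..1} (\<lambda>z. F z * (s * a ^ n * K (1 - z))) =
     integral {0..1} (\<lambda>z. a ^ n * F z - m ^ n * exp (- s) * (exp (s * of_real z) * F z)
       + (\<Sum>j<n. \<Sum>i\<le>j. \<kappa> j i * exp (- m) * (exp (m * of_real z) * ((1 - of_real z) ^ i * F z))))"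
  proof (rule Henstock_Kurzweil_Integration.integral_cong)
    fix z :: real assume "z \<in> {0..1}"
    then have "1 - z \<in> {0..1}" by auto
    have e: "exp (- c * of_real (1 - z)) = exp (- c) * exp (c * of_real z)" for c :: complex
      by (simp add: algebra_simps flip: exp_add)
    show "F z * (s * a ^ n * K (1 - z)) = a ^ n * F z - m ^ n * exp (- s) * (exp (s * of_real z) * F z)
       + (\<Sum>j<n. \<Sum>i\<le>j. \<kappa> j i * exp (- m) * (exp (m * of_real z) * ((1 - of_real z) ^ i * F z)))"
      unfolding K[OF \<open>1 - z \<in> {0..1}\<close>] e
      by (simp add: ring_distribs sum_distrib_left mult_ac)
  qed
  also have "\<dots> = a ^ n * integral {0..1} F - m ^ n * exp (- s) * integral {0..1} (\<lambda>z. exp (s * of_real z) * F z)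
       + (\<Sum>j<n. \<Sum>i\<le>j. \<kappa> j i * exp (- m) * integral {0..1} (\<lambda>z. exp (m * of_real z) * ((1 - of_real z) ^ i * F z)))"
  proof -
    have int: "(\<lambda>z. exp (d * of_real z) * ((1 - of_real z) ^ i * F z)) integrable_on {0..1}" for d i
      by (intro integrable_continuous_interval continuous_intros F)
    have int0: "(\<lambda>z. exp (d * of_real z) * F z) integrable_on {0..1}" for d
      by (intro integrable_continuous_interval continuous_intros F)
    have int1: "F integrable_on {0..1}"
      by (intro integrable_continuous_interval continuous_intros F)
    show ?thesis
      by (intro integral_unique has_integral_add has_integral_diff has_integral_sum
          has_integral_mult_right integrable_integral int int0 int1 finite_lessThan finite_atMost)
  qed
  also have "integral {0..1} F = 1 - of_real \<pi>0"
  proof -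
    have "integral {0..1} F = of_real (integral {0..1} f)"
      unfolding F_def
      using integral_linear[OF integrable_continuous_interval[OF f] bounded_linear_of_real[where 'a = complex]]
      by (simp add: comp_def)
    also have "integral {0..1} f = 1 - \<pi>0"
      using mass by simp
    finally show ?thesis by simp
  qed
  also have "integral {0..1} (\<lambda>z. exp (s * of_real z) * F z) = \<phi> f (- s)"
    by (simp add: \<phi>_eq_unit_transform[OF f] unit_transform_def F_def)
  finally have "s * a ^ n * \<phi> f s + m ^ n * exp (- s) * \<phi> f (- s) =
     of_real \<pi>0 * (a ^ n - m ^ n * exp (- s) + exp (- m) * (\<Sum>j<n. \<Sum>i\<le>j. \<kappa> j i)) + a ^ n * (1 - of_real \<pi>0)
     + (\<Sum>j<n. \<Sum>i\<le>j. \<kappa> j i * exp (- m) * integral {0..1} (\<lambda>z. exp (m * of_real z) * ((1 - of_real z) ^ i * F z)))"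
    by (simp add: K)
  also have "\<dots> = a ^ n - of_real \<pi>0 * m ^ n * exp (- s) + exp (- m) * (\<Sum>j<n. \<Sum>i\<le>j. \<kappa> j i * boundary_weight \<mu> \<pi>0 f i)"
    unfolding boundary_weight_eq[OF f]
    by (simp add: ring_distribs sum.distrib sum_distrib_left mult_ac F_def m_def)
  also have "(\<Sum>j<n. \<Sum>i\<le>j. \<kappa> j i * boundary_weight \<mu> \<pi>0 f i) =
      - poly (boundary_poly n \<mu> (boundary_weight \<mu> \<pi>0 f)) (- s)"
    unfolding poly_boundary_poly by (simp add: \<kappa>_def a_def m_def sum_negf)
  finally have *: "s * a ^ n * \<phi> f s + m ^ n * exp (- s) * \<phi> f (- s) = a ^ n - of_real \<pi>0 * m ^ n * exp (- s)
      - exp (- m) * poly (boundary_poly n \<mu> (boundary_weight \<mu> \<pi>0 f)) (- s)"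
    by simp
  have "- exp (- s) * A n \<mu> \<pi>0 f (- s) = (exp (- s) * exp s) * a ^ n - of_real \<pi>0 * m ^ n * exp (- s)
      - (exp (- s) * exp (- (m + - s))) * poly (boundary_poly n \<mu> (boundary_weight \<mu> \<pi>0 f)) (- s)"
    unfolding A_eq_boundary_poly by (simp add: m_def a_def algebra_simps)
  also have "exp (- s) * exp s = 1"
    by (simp flip: exp_add)
  also have "exp (- s) * exp (- (m + - s)) = exp (- m)"
    by (simp flip: exp_add)
  finally show ?thesis
    using * by (simp add: m_def a_def)
qed

text \<open>
  The half equations at \<open>s\<close> and \<open>- s\<close> are linear in the two unknowns \<^term>\<open>\<phi> f s\<close> and
  \<^term>\<open>\<phi> f (- s)\<close>. Eliminating the second one leaves the determinant of the system, which up to sign is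
  \<^term>\<open>R_poly n \<mu>\<close>.
\<close>

lemma transform_equation:
  fixes s :: complex and \<mu> :: real
  assumes "n \<ge> 1" and "continuous_on {0..1} f"
    and "density_equation (erlang_G n \<mu>) \<pi>0 f"
    and "\<pi>0 + integral {0..1} f = 1"
  shows "- exp (- s) * s * (of_real \<mu> + s) ^ n * A n \<mu> \<pi>0 f (- s) - of_real \<mu> ^ n * A n \<mu> \<pi>0 f s
    = \<phi> f s * poly (R_poly n \<mu>) s"
proof -
  define m where "m = complex_of_real \<mu>"
  define X where "X = (m + s) ^ n"
  define Y where "Y = (m - s) ^ n"
  have XY: "(m\<^sup>2 - s\<^sup>2) ^ n = X * Y"
    by (simp add: X_def Y_def power2_eq_square algebra_simps flip: power_mult_distrib)
  have minus: "s * Y * \<phi> f s + m ^ n * exp (- s) * \<phi> f (- s) = - exp (- s) * A n \<mu> \<pi>0 f (- s)"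
    using half_transform_equation[OF assms, of s] by (simp add: m_def Y_def)
  have plus: "- s * X * \<phi> f (- s) + m ^ n * exp s * \<phi> f s = - exp s * A n \<mu> \<pi>0 f s"
    using half_transform_equation[OF assms, of "- s"] by (simp add: m_def X_def)
  have inv: "exp (- s) * exp s = 1"
    by (simp flip: exp_add)
  have "- exp (- s) * s * X * A n \<mu> \<pi>0 f (- s) - m ^ n * A n \<mu> \<pi>0 f s =
      s * X * (- exp (- s) * A n \<mu> \<pi>0 f (- s)) + m ^ n * exp (- s) * (- exp s * A n \<mu> \<pi>0 f s)"
    using inv by (simp add: algebra_simps)
  also have "\<dots> = (s\<^sup>2 * (X * Y) + m ^ n * m ^ n * (exp (- s) * exp s)) * \<phi> f s"
    unfolding minus[symmetric] plus[symmetric] by (simp add: algebra_simps power2_eq_square)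
  also have "\<dots> = \<phi> f s * poly (R_poly n \<mu>) s"
    unfolding inv XY[symmetric] poly_R_poly by (simp add: m_def mult_2 power_add)
  finally show ?thesis
    by (simp add: X_def m_def)
qed

section \<open>The parts with and without the exponential\<close>

text \<open>
  The polynomials that appear when \<^const>\<open>A\<close> is inserted into the right-hand side of the transform
  equation: the products \<open>exp (- s) * exp s\<close> cancel in the first one.
\<close>

definition exp_free_part :: "nat \<Rightarrow> real \<Rightarrow> real \<Rightarrow> (real \<Rightarrow> real) \<Rightarrow> complex poly" where
  "exp_free_part n \<mu> \<pi>0 f = [:0, 1:] * [:of_real \<mu>, 1:] ^ n *
      ([:of_real \<mu>, - 1:] ^ n
       - smult (exp (- of_real \<mu>)) (pcompose (boundary_poly n \<mu> (boundary_weight \<mu> \<pi>0 f)) [:0, - 1:]))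
     - [:of_real \<pi>0 * of_real \<mu> ^ (2 * n):]"

definition exp_part :: "nat \<Rightarrow> real \<Rightarrow> real \<Rightarrow> (real \<Rightarrow> real) \<Rightarrow> complex poly" where
  "exp_part n \<mu> \<pi>0 f = smult (of_real \<mu> ^ n)
      ([:1, - of_real \<pi>0:] * [:of_real \<mu>, 1:] ^ n
       - smult (exp (- of_real \<mu>)) (boundary_poly n \<mu> (boundary_weight \<mu> \<pi>0 f)))"

lemma exp_part_decomposition:
  "- exp (- s) * s * (of_real \<mu> + s) ^ n * A n \<mu> \<pi>0 f (- s) - of_real \<mu> ^ n * A n \<mu> \<pi>0 f s
    = poly (exp_free_part n \<mu> \<pi>0 f) s + exp (- s) * poly (exp_part n \<mu> \<pi>0 f) s"
proof -
  define m where "m = complex_of_real \<mu>"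
  define b where "b = poly (boundary_poly n \<mu> (boundary_weight \<mu> \<pi>0 f))"
  define X where "X = (m + s) ^ n"
  define Y where "Y = (m - s) ^ n"
  have inv: "exp (- s) * exp s = 1"
    by (simp flip: exp_add)
  have A1: "A n \<mu> \<pi>0 f s = of_real \<pi>0 * m ^ n - exp (- s) * X + exp (- m) * exp (- s) * b s"
    by (simp add: A_eq_boundary_poly m_def b_def X_def flip: exp_add)
  have A2: "A n \<mu> \<pi>0 f (- s) = of_real \<pi>0 * m ^ n - exp s * Y + exp (- m) * exp s * b (- s)"
    by (simp add: A_eq_boundary_poly m_def b_def Y_def flip: exp_add)
  have p: "poly (exp_free_part n \<mu> \<pi>0 f) s = s * X * (Y - exp (- m) * b (- s)) - of_real \<pi>0 * (m ^ n * m ^ n)"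
    by (simp add: exp_free_part_def poly_pcompose X_def Y_def b_def m_def mult_2 power_add)
  have q: "poly (exp_part n \<mu> \<pi>0 f) s = m ^ n * ((1 - of_real \<pi>0 * s) * X - exp (- m) * b s)"
    by (simp add: exp_part_def X_def b_def m_def algebra_simps)
  have "- exp (- s) * s * X * A n \<mu> \<pi>0 f (- s) - m ^ n * A n \<mu> \<pi>0 f s =
      s * X * (exp (- s) * exp s) * (Y - exp (- m) * b (- s)) - of_real \<pi>0 * (m ^ n * m ^ n)
      + exp (- s) * (m ^ n * ((1 - of_real \<pi>0 * s) * X - exp (- m) * b s))"
    unfolding A1 A2 by (simp add: algebra_simps)
  then show ?thesis
    unfolding p q inv by (simp add: X_def m_def)
qed

lemma degree_exp_free_part: "degree (exp_free_part n \<mu> \<pi>0 f) < 2 * n + 2"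
proof -
  have lin: "degree ([:a, b:] ^ n) \<le> n" for a b :: complex
    by (rule order.trans[OF degree_power_le]) (auto simp: degree_pCons_eq_if)
  have comp: "degree (pcompose (boundary_poly n \<mu> w) [:0, - 1:]) \<le> n" for w
    by (rule order.trans[OF degree_pcompose_le]) (use degree_boundary_poly in simp)
  have "degree ([:0, 1:] * [:complex_of_real \<mu>, 1:] ^ n) \<le> n + 1"
    by (rule order.trans[OF degree_mult_le]) (use lin[of "of_real \<mu>" 1] in auto)
  moreover have "degree ([:complex_of_real \<mu>, - 1:] ^ n
       - smult (exp (- of_real \<mu>)) (pcompose (boundary_poly n \<mu> (boundary_weight \<mu> \<pi>0 f)) [:0, - 1:])) \<le> n"
    by (intro degree_diff_le lin order.trans[OF degree_smult_le] comp)
  ultimately have "degree (exp_free_part n \<mu> \<pi>0 f) \<le> 2 * n + 1"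
    unfolding exp_free_part_def
    by (intro degree_diff_le) (auto intro!: order.trans[OF degree_mult_le])
  then show ?thesis by simp
qed

lemma degree_exp_part: "degree (exp_part n \<mu> \<pi>0 f) < 2 * n + 2"
proof -
  have "degree ([:1, - complex_of_real \<pi>0:] * [:of_real \<mu>, 1:] ^ n) \<le> n + 1"
    by (rule order.trans[OF degree_mult_le]) (auto simp: degree_power_eq degree_pCons_eq_if)
  moreover have "degree (boundary_poly n \<mu> (boundary_weight \<mu> \<pi>0 f)) \<le> n + 1"
    by (rule order.trans[OF degree_boundary_poly]) simp
  ultimately have "degree (exp_part n \<mu> \<pi>0 f) \<le> n + 1"
    unfolding exp_part_def by (intro order.trans[OF degree_smult_le] degree_diff_le)
  then show ?thesis by simp
qed

lemma p_poly_eq_exp_free_part: "p_poly n \<mu> \<pi>0 f = exp_free_part n \<mu> \<pi>0 f"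
  unfolding p_poly_def exp_part_decomposition
proof (rule the_equality)
  fix p assume "\<exists>q. \<forall>s. poly (exp_free_part n \<mu> \<pi>0 f) s + exp (- s) * poly (exp_part n \<mu> \<pi>0 f) s =
    poly p s + exp (- s) * poly q s"
  then obtain q where "\<And>s. poly (exp_free_part n \<mu> \<pi>0 f) s + exp (- s) * poly (exp_part n \<mu> \<pi>0 f) s =
    poly p s + exp (- s) * poly q s" by blast
  then have "poly (p - exp_free_part n \<mu> \<pi>0 f) s + exp (- s) * poly (q - exp_part n \<mu> \<pi>0 f) s = 0" for s
    by (simp add: algebra_simps)
  from poly_add_exp_poly_eq_0(1)[OF this] show "p = exp_free_part n \<mu> \<pi>0 f"
    by simp
qed auto

section \<open>Inverting the transform\<close>

text \<open>
  At a zero \<open>r i\<close> of \<open>Q\<close> the left-hand side of the equation vanishes, which determines \<open>q (r i)\<close> from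
  \<open>p (r i)\<close>; by the degree bounds, \<open>q\<close> is then determined by \<open>p\<close>. The sum of exponentials satisfies
  the same equation with the same \<open>p\<close> and \<open>q\<close>, hence has the same transform as \<open>f\<close> away from the
  zeros of \<open>Q\<close>, and by continuity everywhere.
\<close>

lemma density_eq_sum_exp:
  assumes f: "continuous_on {0..1} f"
    and transform: "\<And>s. \<phi> f s * poly Q s = poly p s + exp (- s) * poly q s"
    and deg: "degree p < card I" "degree q < card I" "degree Q = card I"
    and inj: "inj_on r I" and root: "\<And>i. i \<in> I \<Longrightarrow> poly Q (r i) = 0"
    and simple: "\<And>i. i \<in> I \<Longrightarrow> poly (pderiv Q) (r i) \<noteq> 0"
    and x: "x \<in> {0..1}"
  shows "of_real (f x) = (\<Sum>i\<in>I. poly p (r i) / poly (pderiv Q) (r i) * exp (r i * of_real x))"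
proof -
  define c where "c i = poly p (r i) / poly (pderiv Q) (r i)" for i
  have fin: "finite I"
    using deg by (metis card.infinite not_less_zero)
  have "\<forall>i\<in>I. \<exists>k. Q = [:- r i, 1:] * k"
    using root by (auto simp: poly_eq_0_iff_dvd dvd_def)
  then obtain k where k: "\<And>i. i \<in> I \<Longrightarrow> Q = [:- r i, 1:] * k i"
    by metis
  have p: "p = (\<Sum>i\<in>I. smult (c i) (k i))"
    unfolding c_def by (rule interpolation_at_simple_roots) (use inj deg k simple in auto)
  have q_root: "poly q (r i) = - exp (r i) * poly p (r i)" if "i \<in> I" for i
  proof -
    have "poly p (r i) + exp (- r i) * poly q (r i) = 0"
      using transform[of "r i"] root[OF that] by simp
    then have "exp (r i) * poly p (r i) + (exp (r i) * exp (- r i)) * poly q (r i) = 0"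
      by (metis distrib_left mult.assoc mult_zero_right)
    then show ?thesis
      by (simp add: eq_neg_iff_add_eq_0 add.commute flip: exp_add)
  qed
  have "q = (\<Sum>i\<in>I. smult (poly q (r i) / poly (pderiv Q) (r i)) (k i))"
    by (rule interpolation_at_simple_roots) (use inj deg k simple in auto)
  also have "\<dots> = (\<Sum>i\<in>I. smult (- exp (r i) * c i) (k i))"
    by (intro sum.cong refl) (simp add: q_root c_def)
  finally have q: "q = (\<Sum>i\<in>I. smult (- exp (r i) * c i) (k i))" .
  define g where "g x = (\<Sum>i\<in>I. c i * exp (r i * of_real x))" for x :: real
  have g: "continuous_on {0..1} g"
    unfolding g_def by (intro continuous_intros)
  have g_transform: "unit_transform g s * poly Q s = poly p s + exp (- s) * poly q s" for s
  proof -
    have "unit_transform g s * poly Q s =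
        (\<Sum>i\<in>I. c i * unit_transform (\<lambda>x. exp (r i * of_real x)) s) * poly Q s"
      unfolding g_def using fin by (subst unit_transform_sum) (auto intro!: continuous_intros)
    also have "\<dots> = (\<Sum>i\<in>I. c i * poly (k i) s * (1 - exp (r i) * exp (- s)))"
      unfolding sum_distrib_right
    proof (intro sum.cong refl)
      fix i assume "i \<in> I"
      then have "poly Q s = (s - r i) * poly (k i) s"
        by (subst k) (auto simp: algebra_simps)
      then show "c i * unit_transform (\<lambda>x. exp (r i * of_real x)) s * poly Q s =
          c i * poly (k i) s * (1 - exp (r i) * exp (- s))"
        unfolding unit_transform_exp[symmetric] by (simp only: mult_ac)
    qed
    also have "\<dots> = poly p s + exp (- s) * poly q s"
      unfolding p q poly_sum sum_distrib_left sum.distrib[symmetric]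
      by (intro sum.cong refl) (simp add: algebra_simps)
    finally show ?thesis .
  qed
  define h where "h x = of_real (f x) - g x" for x
  have h: "continuous_on {0..1} h"
    unfolding h_def by (intro continuous_intros f g)
  have h_transform: "unit_transform h s = \<phi> f s - unit_transform g s" for s
    unfolding unit_transform_def \<phi>_eq_unit_transform[OF f] h_def right_diff_distrib
    by (rule Henstock_Kurzweil_Integration.integral_diff)
      (intro integrable_continuous_interval continuous_intros f g)+
  \<comment> \<open>A nonzero value would persist near \<open>s\<close>, but \<open>Q\<close> has only isolated zeros.\<close>
  have "unit_transform h s = 0" for s
  proof (rule ccontr)
    assume nz: "unit_transform h s \<noteq> 0"
    have "isCont (unit_transform h) s"
      using unit_transform_has_field_derivative[OF h] by (rule DERIV_isCont)
    then have "\<forall>\<^sub>F t in at s. unit_transform h t \<noteq> 0"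
      using nz by (auto simp: isCont_def intro: tendsto_imp_eventually_ne)
    moreover have "unit_transform h t * poly Q t = 0" for t
      by (simp add: h_transform left_diff_distrib transform g_transform)
    ultimately have "\<forall>\<^sub>F t in at s. poly Q t = 0"
      by (auto elim!: eventually_mono)
    moreover have "Q \<noteq> 0"
      using deg by auto
    then have "\<forall>\<^sub>F t in at s. poly Q t \<noteq> 0"
      using islimpt_finite[OF poly_roots_finite, of Q s] by (simp add: islimpt_iff_eventually)
    ultimately have "\<forall>\<^sub>F t in at s. False"
      by eventually_elim simp
    then show False by simp
  qed
  from unit_transform_zero_imp_zero[OF h this x] show ?thesis
    by (simp add: h_def g_def c_def)
qed

section \<open>The zeros of the characteristic polynomial\<close>

text \<open>
  The derivative of \<^term>\<open>R_poly n \<mu>\<close> is \<open>2 s (\<mu>^2 - s^2)^(n - 1) (\<mu>^2 - (n + 1) s^2)\<close>. Neither \<open>s\<close> nor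
  \<open>\<mu>^2 - s^2\<close> vanishes at a zero of \<^term>\<open>R_poly n \<mu>\<close>. If the last factor does, then \<open>s^2\<close> is a real number
  between \<open>0\<close> and \<open>\<mu>^2\<close>, which makes the value of \<^term>\<open>R_poly n \<mu>\<close> positive.
\<close>

lemma zeros_nonzero_simple:
  fixes \<mu> :: real
  assumes "\<mu> > 0" "n \<ge> 1" and root: "poly (R_poly n \<mu>) s = 0"
  shows "s \<noteq> 0" "poly (pderiv (R_poly n \<mu>)) s \<noteq> 0"
proof -
  define m where "m = complex_of_real \<mu>"
  obtain k where k: "n = Suc k"
    using assms by (cases n) auto
  have m: "m \<noteq> 0"
    using assms by (simp add: m_def)
  have R: "s\<^sup>2 * (m\<^sup>2 - s\<^sup>2) ^ n + m ^ (2 * n) = 0"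
    using root by (simp add: poly_R_poly m_def)
  show "s \<noteq> 0"
    using R m by auto
  have ne: "m\<^sup>2 - s\<^sup>2 \<noteq> 0"
    using R m assms by (auto simp: power_0_left)
  show "poly (pderiv (R_poly n \<mu>)) s \<noteq> 0"
  proof
    assume "poly (pderiv (R_poly n \<mu>)) s = 0"
    moreover have "poly (pderiv (R_poly n \<mu>)) s =
      2 * s * (m\<^sup>2 - s\<^sup>2) ^ k * (m\<^sup>2 - of_nat (n + 1) * s\<^sup>2)"
    proof -
      have "poly (pderiv (R_poly n \<mu>)) s = 2 * s * (m\<^sup>2 - s\<^sup>2) ^ n + s\<^sup>2 * (of_nat n * (m\<^sup>2 - s\<^sup>2) ^ k * (- 2 * s))"
      proof (rule DERIV_unique[OF poly_DERIV])
        have sq: "((\<lambda>s. s\<^sup>2) has_field_derivative 2 * s) (at s)"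
          and base: "((\<lambda>s. m\<^sup>2 - s\<^sup>2) has_field_derivative - 2 * s) (at s)"
          by (auto intro!: derivative_eq_intros)
        have "((\<lambda>s. s\<^sup>2 * (m\<^sup>2 - s\<^sup>2) ^ n + m ^ (2 * n)) has_field_derivative
           2 * s * (m\<^sup>2 - s\<^sup>2) ^ n + s\<^sup>2 * (of_nat n * (m\<^sup>2 - s\<^sup>2) ^ k * (- 2 * s))) (at s)"
          using DERIV_add[OF DERIV_mult[OF sq DERIV_power[OF base, of n]] DERIV_const[of "m ^ (2 * n)"]]
          by (simp add: k mult_ac)
        then show "(poly (R_poly n \<mu>) has_field_derivative
           2 * s * (m\<^sup>2 - s\<^sup>2) ^ n + s\<^sup>2 * (of_nat n * (m\<^sup>2 - s\<^sup>2) ^ k * (- 2 * s))) (at s)"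
          by (rule DERIV_cong_ev[THEN iffD1, rotated -1]) (auto simp: poly_R_poly m_def)
      qed
      also have "\<dots> = 2 * s * (m\<^sup>2 - s\<^sup>2) ^ k * (m\<^sup>2 - of_nat (n + 1) * s\<^sup>2)"
        unfolding k power_Suc by (simp add: algebra_simps power2_eq_square)
      finally show ?thesis .
    qed
    ultimately have "m\<^sup>2 = of_nat (n + 1) * s\<^sup>2"
      using ne \<open>s \<noteq> 0\<close> by auto
    then have s2: "s\<^sup>2 = of_real (\<mu>\<^sup>2 / real (n + 1))"
      by (simp add: m_def field_simps del: of_nat_Suc)
    have "of_real (\<mu>\<^sup>2 / real (n + 1) * (\<mu>\<^sup>2 - \<mu>\<^sup>2 / real (n + 1)) ^ n + \<mu> ^ (2 * n)) = (0 :: complex)"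
      using R unfolding s2 m_def by simp
    then have "\<mu>\<^sup>2 / real (n + 1) * (\<mu>\<^sup>2 - \<mu>\<^sup>2 / real (n + 1)) ^ n + \<mu> ^ (2 * n) = 0"
      by (simp only: of_real_eq_0_iff)
    moreover have "\<mu>\<^sup>2 / real (n + 1) * (\<mu>\<^sup>2 - \<mu>\<^sup>2 / real (n + 1)) ^ n \<ge> 0"
      by (intro mult_nonneg_nonneg zero_le_power) (auto simp: field_simps)
    moreover have "\<mu> ^ (2 * n) > 0"
      using assms by simp
    ultimately show False by linarith
  qed
qed

lemma lists_zeros_root:
  assumes zeros: "lists_zeros n \<mu> r" and i: "i \<in> {1..2 * n + 2}"
  shows "poly (R_poly n \<mu>) (r i) = 0"
proof -
  have "poly (\<Prod>k\<in>{1..2 * n + 2}. [:- r k, 1:]) (r i) = 0"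
    unfolding poly_prod by (rule prod_zero[OF finite_atLeastAtMost bexI[OF _ i]]) simp
  then show ?thesis
    by (subst zeros[unfolded lists_zeros_def]) simp
qed

text \<open>
  A value listed twice would be a multiple zero.
\<close>

lemma inj_on_lists_zeros:
  assumes \<mu>: "\<mu> > 0" "n \<ge> 1" and zeros: "lists_zeros n \<mu> r"
  shows "inj_on r {1..2 * n + 2}"
proof (rule inj_onI, rule ccontr)
  fix i j assume ij: "i \<in> {1..2 * n + 2}" "j \<in> {1..2 * n + 2}" "r i = r j" "i \<noteq> j"
  define rest where "rest = smult (lead_coeff (R_poly n \<mu>)) (\<Prod>k\<in>{1..2 * n + 2} - {i} - {j}. [:- r k, 1:])"
  have "R_poly n \<mu> = [:- r i, 1:] * ([:- r i, 1:] * rest)"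
    by (subst zeros[unfolded lists_zeros_def]; unfold rest_def;
        subst prod.remove[of _ i]; (subst prod.remove[of _ j])?; use ij in \<open>auto simp: mult_ac\<close>)
  from arg_cong[OF this, of "\<lambda>p. poly (pderiv p) (r i)"]
  have "poly (pderiv (R_poly n \<mu>)) (r i) = 0"
    by (simp add: pderiv_mult pderiv_pCons del: mult_pCons_left)
  with zeros_nonzero_simple(2)[OF \<mu> lists_zeros_root[OF zeros ij(1)]] show False
    by simp
qed

lemma degree_R_poly:
  assumes "\<mu> > 0" and zeros: "lists_zeros n \<mu> r"
  shows "degree (R_poly n \<mu>) = 2 * n + 2"
proof -
  have "poly (R_poly n \<mu>) 0 \<noteq> 0"
    using assms by (simp add: poly_R_poly)
  then have "R_poly n \<mu> \<noteq> 0" by auto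
  moreover have "degree (\<Prod>i\<in>{1..2 * n + 2}. [:- r i, 1:]) = 2 * n + 2"
    by (subst degree_prod_eq_sum_degree) auto
  ultimately show ?thesis
    by (subst zeros[unfolded lists_zeros_def]) auto
qed

section \<open>The equilibrium waiting time\<close>

theorem theorem2:
  fixes n :: nat and \<mu> :: real
    and M :: "'a measure" and R P W :: "'a \<Rightarrow> real"
    and \<pi>0 :: real and f :: "real \<Rightarrow> real" and r :: "nat \<Rightarrow> complex"
  assumes "\<mu> > 0" and "n \<ge> 1"
    and "prob_space M"
    and indep: "prob_space.indep_vars M (\<lambda>_. borel) ((!) [R, P, W]) {..<3}"
    and rotation: "distr M borel R = uniform_measure lborel {0..<1}"
    and pick: "\<forall>x. cdf (distr M borel P) x = erlang_G n \<mu> x"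
    and equilibrium: "distr M borel W = distr M borel (\<lambda>\<omega>. max 0 (R \<omega> - P \<omega> - W \<omega>))"
    and atom: "\<pi>0 = measure M {\<omega> \<in> space M. W \<omega> = 0}"
    and density: "has_atom_and_density (distr M borel W) \<pi>0 f"
    and version: "density_equation (erlang_G n \<mu>) \<pi>0 f"
    and zeros: "lists_zeros n \<mu> r"
  shows "inj_on r {1..2 * n + 2} \<and> (\<forall>i\<in>{1..2 * n + 2}. r i \<noteq> 0)
    \<and> (\<forall>x\<in>{0..1}. complex_of_real (f x) =
          (\<Sum>i=1..2 * n + 2. coef n \<mu> \<pi>0 f (r i) * exp (r i * complex_of_real x)))
    \<and> complex_of_real \<pi>0 =
          1 + (\<Sum>i=1..2 * n + 2. coef n \<mu> \<pi>0 f (r i) / r i * (1 - exp (r i)))"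
proof -
  note pos = \<open>\<mu> > 0\<close> \<open>n \<ge> 1\<close>
  let ?I = "{1..2 * n + 2}"
  interpret prob_space M by fact
  have root: "poly (R_poly n \<mu>) (r i) = 0" if "i \<in> ?I" for i
    by (rule lists_zeros_root[OF zeros that])
  have nonzero: "r i \<noteq> 0" if "i \<in> ?I" for i
    by (rule zeros_nonzero_simple(1)[OF pos root[OF that]])
  have f: "continuous_on {0..1} f"
    using density_continuous[OF pos(2)] density version by (simp add: has_atom_and_density_def)
  have "\<forall>i\<in>{..<3}. [R, P, W] ! i \<in> borel_measurable M"
    using indep unfolding indep_vars_def by blast
  then have "[R, P, W] ! 2 \<in> borel_measurable M"
    by (rule bspec) simp
  then have "prob_space (distr M borel W)"
    by (intro prob_space_distr) simp
  then have "measure (distr M borel W) UNIV = 1"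
    using prob_space.prob_space[of "distr M borel W"] by simp
  moreover have "(LBINT x:{0..1}. f x) = integral {0..1} f"
    by (intro set_borel_integral_eq_integral borel_integrable_atLeastAtMost' f)
  ultimately have mass: "\<pi>0 + integral {0..1} f = 1"
    using density by (simp add: has_atom_and_density_def)
  have f_eq: "of_real (f x) = (\<Sum>i\<in>?I. coef n \<mu> \<pi>0 f (r i) * exp (r i * of_real x))"
    if "x \<in> {0..1}" for x
    unfolding coef_def p_poly_eq_exp_free_part
  proof (rule density_eq_sum_exp[OF f])
    show "\<phi> f s * poly (R_poly n \<mu>) s =
        poly (exp_free_part n \<mu> \<pi>0 f) s + exp (- s) * poly (exp_part n \<mu> \<pi>0 f) s" for s
      using transform_equation[OF pos(2) f version mass] by (simp only: exp_part_decomposition)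
  qed (use that root zeros_nonzero_simple(2)[OF pos root] inj_on_lists_zeros[OF pos zeros]
      degree_exp_free_part degree_exp_part degree_R_poly[OF pos(1) zeros] in auto)
  have "of_real \<pi>0 = 1 - \<phi> f 0"
  proof -
    have "\<phi> f 0 = of_real (integral {0..1} f)"
      using integral_linear[OF integrable_continuous_interval[OF f] bounded_linear_of_real[where 'a = complex]]
      by (simp add: \<phi>_eq_unit_transform[OF f] unit_transform_def comp_def)
    then show ?thesis
      using mass by (simp add: eq_diff_eq flip: of_real_add)
  qed
  also have "\<phi> f 0 = unit_transform (\<lambda>x. \<Sum>i\<in>?I. coef n \<mu> \<pi>0 f (r i) * exp (r i * of_real x)) 0"
    unfolding \<phi>_eq_unit_transform[OF f] unit_transform_def
    by (rule Henstock_Kurzweil_Integration.integral_cong) (simp only: f_eq)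
  also have "\<dots> = (\<Sum>i\<in>?I. coef n \<mu> \<pi>0 f (r i) * unit_transform (\<lambda>x. exp (r i * of_real x)) 0)"
    by (rule unit_transform_sum) (auto intro!: continuous_intros)
  also have "\<dots> = - (\<Sum>i\<in>?I. coef n \<mu> \<pi>0 f (r i) / r i * (1 - exp (r i)))"
    unfolding sum_negf[symmetric]
  proof (intro sum.cong refl)
    fix i assume "i \<in> ?I"
    then have "unit_transform (\<lambda>x. exp (r i * of_real x)) 0 = - (1 - exp (r i)) / r i"
      using unit_transform_exp[of 0 "r i"] nonzero by (simp add: field_simps)
    then show "coef n \<mu> \<pi>0 f (r i) * unit_transform (\<lambda>x. exp (r i * of_real x)) 0 =
        - (coef n \<mu> \<pi>0 f (r i) / r i * (1 - exp (r i)))"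
      by simp (simp add: right_diff_distrib diff_divide_distrib)
  qed
  finally show ?thesis
    using f_eq nonzero inj_on_lists_zeros[OF pos zeros] by simp
qed

end
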